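(* Let $a,b$ be real numbers with $b>a\geqslant 0$, and let $\langle\alpha_n\rangle_{n>0}$ be a sequence of positive real numbers such that $\sum_{n>0}\alpha_n$ converges and, for every $n>0$, $\sum_{i>n}\alpha_i<\alpha_n(1-a/b)$. Let $\boldsymbol\psi_1,\boldsymbol\psi_2,\dots$ be a list of all the sentences of the fixed countable language. For a theory $T$ put $$\sigma_n^{\langle a,b\rangle}(T)=\begin{cases}a&\text{if }T\nvdash\boldsymbol\psi_n,\\ b&\text{if }T\vdash\boldsymbol\psi_n,\end{cases}\qquad \mathscr{V}^{\langle a,b\rangle}_{\alpha}(T)=\sum_{n>0}\alpha_n\,\sigma_n^{\langle a,b\rangle}(T).$$ Then $\mathscr{V}^{\langle a,b\rangle}_{\alpha}$ satisfies both HP and EP for all theories; that is, for all theories $T$ and $U$: (HP) if $\mathscr{V}^{\langle a,b\rangle}_{\alpha}(U)>\mathscr{V}^{\langle a,b\rangle}_{\alpha}(T)$ then $T\nvdash U$; and (EP) if $\mathscr{V}^{\langle a,b\rangle}_{\alpha}(T)=\mathscr{V}^{\langle a,b\rangle}_{\alpha}(U)$ then $T\equiv U$.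
   Context: Fix a countable language and classical (propositional or first-order) logic over it. A theory is an arbitrary set of sentences. $T\vdash\psi$ means $\psi$ is provable from $T$; for theories $T,U$, $T\vdash U$ means $T$ proves every sentence in $U$, and $T\equiv U$ means $T\vdash U$ and $U\vdash T$. *)

theory Defs
  imports Complex_Main "HOL-Library.Countable_Set"
begin

section \<open>Propositional logic over a set of atoms\<close>

text \<open>Falsum and implication are primitive; the other connectives are definable from them.
  The calculus is a Hilbert system, and derivations stay within the given language.\<close>

datatype 'p pform = PAtom 'p | PBot | PImp "'p pform" "'p pform"

fun atoms :: "'p pform \<Rightarrow> 'p set" where
  "atoms (PAtom p) = {p}"
| "atoms PBot = {}"
| "atoms (PImp \<phi> \<psi>) = atoms \<phi> \<union> atoms \<psi>"

definition prop_sentences :: "'p set \<Rightarrow> 'p pform set" where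
  "prop_sentences A = {\<phi>. atoms \<phi> \<subseteq> A}"

inductive prop_provable :: "'p set \<Rightarrow> 'p pform set \<Rightarrow> 'p pform \<Rightarrow> bool"
  for A :: "'p set" and T :: "'p pform set" where
  PAssm: "\<phi> \<in> T \<Longrightarrow> prop_provable A T \<phi>"
| PK: "\<lbrakk>\<phi> \<in> prop_sentences A; \<psi> \<in> prop_sentences A\<rbrakk>
    \<Longrightarrow> prop_provable A T (PImp \<phi> (PImp \<psi> \<phi>))"
| PS: "\<lbrakk>\<phi> \<in> prop_sentences A; \<psi> \<in> prop_sentences A; \<chi> \<in> prop_sentences A\<rbrakk>
    \<Longrightarrow> prop_provable A T
          (PImp (PImp \<phi> (PImp \<psi> \<chi>)) (PImp (PImp \<phi> \<psi>) (PImp \<phi> \<chi>)))"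
| PDN: "\<phi> \<in> prop_sentences A
    \<Longrightarrow> prop_provable A T (PImp (PImp (PImp \<phi> PBot) PBot) \<phi>)"
| PMP: "\<lbrakk>prop_provable A T (PImp \<phi> \<psi>); prop_provable A T \<phi>\<rbrakk> \<Longrightarrow> prop_provable A T \<psi>"


section \<open>First-order logic over a language\<close>

text \<open>Constants are function symbols of arity 0. The flag \<open>has_eq\<close> says whether identity
  belongs to the logic, so that first-order logic with and without identity are both covered.\<close>

record ('f, 'r) language =
  funs :: "'f set"
  fun_arity :: "'f \<Rightarrow> nat"
  rels :: "'r set"
  rel_arity :: "'r \<Rightarrow> nat"
  has_eq :: bool

definition countable_language :: "('f, 'r) language \<Rightarrow> bool" where
  "countable_language L \<longleftrightarrow> countable (funs L) \<and> countable (rels L)"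

datatype 'f trm = Var nat | Fn 'f "'f trm list"

datatype ('f, 'r) form =
    Bot
  | Eq "'f trm" "'f trm"
  | Rel 'r "'f trm list"
  | Imp "('f, 'r) form" "('f, 'r) form"
  | All nat "('f, 'r) form"

fun wf_trm :: "('f, 'r) language \<Rightarrow> 'f trm \<Rightarrow> bool" where
  "wf_trm L (Var x) \<longleftrightarrow> True"
| "wf_trm L (Fn f ts) \<longleftrightarrow>
    f \<in> funs L \<and> length ts = fun_arity L f \<and> (\<forall>t \<in> set ts. wf_trm L t)"

fun wf_form :: "('f, 'r) language \<Rightarrow> ('f, 'r) form \<Rightarrow> bool" where
  "wf_form L Bot \<longleftrightarrow> True"
| "wf_form L (Eq s t) \<longleftrightarrow> has_eq L \<and> wf_trm L s \<and> wf_trm L t"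
| "wf_form L (Rel r ts) \<longleftrightarrow>
    r \<in> rels L \<and> length ts = rel_arity L r \<and> (\<forall>t \<in> set ts. wf_trm L t)"
| "wf_form L (Imp \<phi> \<psi>) \<longleftrightarrow> wf_form L \<phi> \<and> wf_form L \<psi>"
| "wf_form L (All x \<phi>) \<longleftrightarrow> wf_form L \<phi>"

fun fv_trm :: "'f trm \<Rightarrow> nat set" where
  "fv_trm (Var x) = {x}"
| "fv_trm (Fn f ts) = (\<Union>t \<in> set ts. fv_trm t)"

fun fv :: "('f, 'r) form \<Rightarrow> nat set" where
  "fv Bot = {}"
| "fv (Eq s t) = fv_trm s \<union> fv_trm t"
| "fv (Rel r ts) = (\<Union>t \<in> set ts. fv_trm t)"
| "fv (Imp \<phi> \<psi>) = fv \<phi> \<union> fv \<psi>"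
| "fv (All x \<phi>) = fv \<phi> - {x}"

definition fo_sentences :: "('f, 'r) language \<Rightarrow> ('f, 'r) form set" where
  "fo_sentences L = {\<phi>. wf_form L \<phi> \<and> fv \<phi> = {}}"

fun subst_trm :: "nat \<Rightarrow> 'f trm \<Rightarrow> 'f trm \<Rightarrow> 'f trm" where
  "subst_trm x u (Var y) = (if y = x then u else Var y)"
| "subst_trm x u (Fn f ts) = Fn f (map (subst_trm x u) ts)"

text \<open>Substitution replaces the free occurrences without renaming bound variables; it is only
  used under the side condition \<open>free_for\<close>, which excludes variable capture.\<close>

fun subst :: "nat \<Rightarrow> 'f trm \<Rightarrow> ('f, 'r) form \<Rightarrow> ('f, 'r) form" where
  "subst x u Bot = Bot"
| "subst x u (Eq s t) = Eq (subst_trm x u s) (subst_trm x u t)"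
| "subst x u (Rel r ts) = Rel r (map (subst_trm x u) ts)"
| "subst x u (Imp \<phi> \<psi>) = Imp (subst x u \<phi>) (subst x u \<psi>)"
| "subst x u (All y \<phi>) = (if y = x then All y \<phi> else All y (subst x u \<phi>))"

fun free_for :: "'f trm \<Rightarrow> nat \<Rightarrow> ('f, 'r) form \<Rightarrow> bool" where
  "free_for u x Bot \<longleftrightarrow> True"
| "free_for u x (Eq s t) \<longleftrightarrow> True"
| "free_for u x (Rel r ts) \<longleftrightarrow> True"
| "free_for u x (Imp \<phi> \<psi>) \<longleftrightarrow> free_for u x \<phi> \<and> free_for u x \<psi>"
| "free_for u x (All y \<phi>) \<longleftrightarrow> x \<notin> fv (All y \<phi>) \<or> (y \<notin> fv_trm u \<and> free_for u x \<phi>)"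

text \<open>A Hilbert system in the style of Mendelson. Generalization is unrestricted, which is
  harmless because theories consist of sentences.\<close>

inductive fo_provable ::
    "('f, 'r) language \<Rightarrow> ('f, 'r) form set \<Rightarrow> ('f, 'r) form \<Rightarrow> bool"
  for L :: "('f, 'r) language" and T :: "('f, 'r) form set" where
  Assm: "\<phi> \<in> T \<Longrightarrow> fo_provable L T \<phi>"
| K: "\<lbrakk>wf_form L \<phi>; wf_form L \<psi>\<rbrakk> \<Longrightarrow> fo_provable L T (Imp \<phi> (Imp \<psi> \<phi>))"
| S: "\<lbrakk>wf_form L \<phi>; wf_form L \<psi>; wf_form L \<chi>\<rbrakk>
    \<Longrightarrow> fo_provable L T (Imp (Imp \<phi> (Imp \<psi> \<chi>)) (Imp (Imp \<phi> \<psi>) (Imp \<phi> \<chi>)))"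
| DN: "wf_form L \<phi> \<Longrightarrow> fo_provable L T (Imp (Imp (Imp \<phi> Bot) Bot) \<phi>)"
| Inst: "\<lbrakk>wf_form L \<phi>; wf_trm L t; free_for t x \<phi>\<rbrakk>
    \<Longrightarrow> fo_provable L T (Imp (All x \<phi>) (subst x t \<phi>))"
| Distr: "\<lbrakk>wf_form L \<phi>; wf_form L \<psi>; x \<notin> fv \<phi>\<rbrakk>
    \<Longrightarrow> fo_provable L T (Imp (All x (Imp \<phi> \<psi>)) (Imp \<phi> (All x \<psi>)))"
| EqRefl: "\<lbrakk>has_eq L; wf_trm L t\<rbrakk> \<Longrightarrow> fo_provable L T (Eq t t)"
| EqSubst: "\<lbrakk>has_eq L; wf_form L \<phi>; wf_trm L s; wf_trm L t; free_for s x \<phi>; free_for t x \<phi>\<rbrakk>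
    \<Longrightarrow> fo_provable L T (Imp (Eq s t) (Imp (subst x s \<phi>) (subst x t \<phi>)))"
| MP: "\<lbrakk>fo_provable L T (Imp \<phi> \<psi>); fo_provable L T \<phi>\<rbrakk> \<Longrightarrow> fo_provable L T \<psi>"
| Gen: "fo_provable L T \<phi> \<Longrightarrow> fo_provable L T (All x \<phi>)"


section \<open>Theories and valuations\<close>

text \<open>The notions below are parametrized by a provability relation \<open>prov\<close> and, where they
  quantify over theories, by the set \<open>S\<close> of all sentences.\<close>

definition proves_theory :: "('s set \<Rightarrow> 's \<Rightarrow> bool) \<Rightarrow> 's set \<Rightarrow> 's set \<Rightarrow> bool" where
  "proves_theory prov T U \<longleftrightarrow> (\<forall>\<psi> \<in> U. prov T \<psi>)"

definition equiv_theory :: "('s set \<Rightarrow> 's \<Rightarrow> bool) \<Rightarrow> 's set \<Rightarrow> 's set \<Rightarrow> bool" where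
  "equiv_theory prov T U \<longleftrightarrow> proves_theory prov T U \<and> proves_theory prov U T"

definition sigma ::
    "('s set \<Rightarrow> 's \<Rightarrow> bool) \<Rightarrow> (nat \<Rightarrow> 's) \<Rightarrow> real \<Rightarrow> real \<Rightarrow> nat \<Rightarrow> 's set \<Rightarrow> real" where
  "sigma prov \<psi> a b n T = (if prov T (\<psi> n) then b else a)"

text \<open>Sequences are indexed by the positive integers; their value at 0 is irrelevant.\<close>

definition valuation ::
    "('s set \<Rightarrow> 's \<Rightarrow> bool) \<Rightarrow> (nat \<Rightarrow> 's) \<Rightarrow> real \<Rightarrow> real \<Rightarrow> (nat \<Rightarrow> real) \<Rightarrow> 's set \<Rightarrow> real" where
  "valuation prov \<psi> a b \<alpha> T = (\<Sum>n. \<alpha> (Suc n) * sigma prov \<psi> a b (Suc n) T)"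

definition HP :: "'s set \<Rightarrow> ('s set \<Rightarrow> 's \<Rightarrow> bool) \<Rightarrow> ('s set \<Rightarrow> real) \<Rightarrow> bool" where
  "HP S prov V \<longleftrightarrow>
    (\<forall>T U. T \<subseteq> S \<and> U \<subseteq> S \<and> V U > V T \<longrightarrow> \<not> proves_theory prov T U)"

definition EP :: "'s set \<Rightarrow> ('s set \<Rightarrow> 's \<Rightarrow> bool) \<Rightarrow> ('s set \<Rightarrow> real) \<Rightarrow> bool" where
  "EP S prov V \<longleftrightarrow>
    (\<forall>T U. T \<subseteq> S \<and> U \<subseteq> S \<and> V T = V U \<longrightarrow> equiv_theory prov T U)"

end

theory Submission
  imports "HOL-Analysis.Infinite_Sum" Defs
begin

text \<open>Up to a positive scaling and a constant, the value of \<open>T\<close> is the total weight of the set of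
  indices of the listed sentences that \<open>T\<close> proves. By cut, a stronger theory has a larger set, which
  gives HP. For EP, the set can be recovered from its weight: every weight exceeds the sum of all
  later ones, so the least index that lies in only one of two sets decides which is heavier.\<close>

definition superdecreasing_on :: "('i::linorder \<Rightarrow> real) \<Rightarrow> 'i set \<Rightarrow> bool" where
  "superdecreasing_on \<beta> I \<longleftrightarrow> (\<forall>n\<in>I. infsum \<beta> {i\<in>I. n < i} < \<beta> n)"

lemma infsum_less_if_first_difference:
  fixes \<beta> :: "'i::linorder \<Rightarrow> real"
  assumes summable: "\<beta> summable_on I" and nonneg: "\<And>i. i \<in> I \<Longrightarrow> 0 \<le> \<beta> i"
    and "superdecreasing_on \<beta> I" and "X \<subseteq> I" "Y \<subseteq> I"
    and "n \<in> X" "n \<notin> Y" and agree: "\<And>i. i < n \<Longrightarrow> i \<in> X \<longleftrightarrow> i \<in> Y"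
  shows "infsum \<beta> Y < infsum \<beta> X"
proof -
  define below where "below = {i\<in>X. i < n}"
  have summable_subset: "\<beta> summable_on Z" if "Z \<subseteq> I" for Z
    using summable that by (rule summable_on_subset_banach)
  have "n \<in> I" and "below \<subseteq> I" and "n \<notin> below"
    using \<open>n \<in> X\<close> \<open>X \<subseteq> I\<close> by (auto simp: below_def)
  have "Y \<subseteq> below \<union> {i\<in>I. n < i}"
  proof
    fix i
    assume "i \<in> Y"
    then have "i < n \<or> n < i"
      using \<open>n \<notin> Y\<close> by (metis linorder_neqE)
    then show "i \<in> below \<union> {i\<in>I. n < i}"
      using \<open>i \<in> Y\<close> \<open>Y \<subseteq> I\<close> agree by (auto simp: below_def)
  qed
  then have "infsum \<beta> Y \<le> infsum \<beta> (below \<union> {i\<in>I. n < i})"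
    using \<open>below \<subseteq> I\<close> \<open>Y \<subseteq> I\<close> nonneg by (intro infsum_mono2 summable_subset) auto
  also have "\<dots> = infsum \<beta> below + infsum \<beta> {i\<in>I. n < i}"
    using \<open>below \<subseteq> I\<close> by (intro infsum_Un_disjoint summable_subset) (auto simp: below_def)
  also have "\<dots> < infsum \<beta> below + \<beta> n"
    using \<open>superdecreasing_on \<beta> I\<close> \<open>n \<in> I\<close> by (simp add: superdecreasing_on_def)
  also have "\<dots> = infsum \<beta> (insert n below)"
    using \<open>n \<notin> below\<close> summable_subset[OF \<open>below \<subseteq> I\<close>] by (simp add: infsum_insert)
  also have "\<dots> \<le> infsum \<beta> X"
    using \<open>X \<subseteq> I\<close> \<open>n \<in> X\<close> nonneg by (intro infsum_mono2 summable_subset) (auto simp: below_def)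
  finally show ?thesis .
qed

lemma inj_on_infsum_if_superdecreasing:
  fixes \<beta> :: "'i::wellorder \<Rightarrow> real"
  assumes "\<beta> summable_on I" and "\<And>i. i \<in> I \<Longrightarrow> 0 \<le> \<beta> i" and "superdecreasing_on \<beta> I"
  shows "inj_on (infsum \<beta>) (Pow I)"
proof (intro inj_onI, rule ccontr)
  fix X Y
  assume "X \<in> Pow I" "Y \<in> Pow I"
  then have "X \<subseteq> I" "Y \<subseteq> I" by auto
  assume same_sum: "infsum \<beta> X = infsum \<beta> Y" and "X \<noteq> Y"
  have "\<exists>i. (i \<in> X) \<noteq> (i \<in> Y)"
    using \<open>X \<noteq> Y\<close> by blast
  then obtain n where differ: "(n \<in> X) \<noteq> (n \<in> Y)"
    and agree: "\<And>i. i < n \<Longrightarrow> i \<in> X \<longleftrightarrow> i \<in> Y"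
    unfolding exists_least_iff[of "\<lambda>i. (i \<in> X) \<noteq> (i \<in> Y)"] by blast
  have "infsum \<beta> Y < infsum \<beta> X \<or> infsum \<beta> X < infsum \<beta> Y"
    using differ agree infsum_less_if_first_difference[OF assms \<open>X \<subseteq> I\<close> \<open>Y \<subseteq> I\<close>, of n]
      infsum_less_if_first_difference[OF assms \<open>Y \<subseteq> I\<close> \<open>X \<subseteq> I\<close>, of n]
    by blast
  with same_sum show False by simp
qed

lemma infsum_greaterThan_eq_suminf:
  fixes f :: "nat \<Rightarrow> 'a::{comm_monoid_add, t2_space}"
  assumes "f summable_on {n<..}"
  shows "infsum f {n<..} = (\<Sum>i. f (n + 1 + i))"
proof -
  have "bij_betw (\<lambda>i. n + 1 + i) UNIV {n<..}"
    by (rule bij_betwI[where g = "\<lambda>m. m - n - 1"]) auto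
  then have "((\<lambda>i. f (n + 1 + i)) has_sum infsum f {n<..}) UNIV"
    using assms by (simp only: has_sum_reindex_bij_betw has_sum_infsum)
  then show ?thesis
    by (intro sums_unique has_sum_imp_sums)
qed

lemma superdecreasing_on_if_suminf_tail_less:
  assumes summable: "\<alpha> summable_on {0<..}" and nonneg: "\<And>n. 0 < n \<Longrightarrow> 0 \<le> \<alpha> n"
    and tail: "\<And>n::nat. 0 < n \<Longrightarrow> (\<Sum>i. \<alpha> (n + 1 + i)) < \<alpha> n * c" and "c \<le> 1"
  shows "superdecreasing_on \<alpha> {0<..}"
  unfolding superdecreasing_on_def
proof
  fix n :: nat
  assume "n \<in> {0<..}"
  then have "0 < n" by simp
  have "{i\<in>{0<..}. n < i} = {n<..}" by auto
  moreover have "\<alpha> summable_on {n<..}"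
    using summable by (rule summable_on_subset_banach) auto
  ultimately have "infsum \<alpha> {i\<in>{0<..}. n < i} = (\<Sum>i. \<alpha> (n + 1 + i))"
    by (simp only: infsum_greaterThan_eq_suminf)
  also have "\<dots> < \<alpha> n * c"
    using \<open>0 < n\<close> by (rule tail)
  also have "\<dots> \<le> \<alpha> n"
    using nonneg[OF \<open>0 < n\<close>] \<open>c \<le> 1\<close> by (rule mult_left_le[rotated])
  finally show "infsum \<alpha> {i\<in>{0<..}. n < i} < \<alpha> n" .
qed

definition proved_indices :: "('s set \<Rightarrow> 's \<Rightarrow> bool) \<Rightarrow> (nat \<Rightarrow> 's) \<Rightarrow> 's set \<Rightarrow> nat set" where
  "proved_indices prov \<psi> T = {n. 0 < n \<and> prov T (\<psi> n)}"

lemma proved_indices_subset: "proved_indices prov \<psi> T \<subseteq> {0<..}"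
  by (auto simp: proved_indices_def)

lemma valuation_eq_infsum_proved_indices:
  assumes "\<alpha> summable_on {0<..}"
  shows "valuation prov \<psi> a b \<alpha> T =
    a * infsum \<alpha> {0<..} + (b - a) * infsum \<alpha> (proved_indices prov \<psi> T)"
proof -
  let ?P = "proved_indices prov \<psi> T"
  have "(\<alpha> has_sum infsum \<alpha> ?P) ?P"
    by (intro has_sum_infsum summable_on_subset_banach[OF assms] proved_indices_subset)
  also have "?this \<longleftrightarrow> ((\<lambda>n. if n \<in> ?P then \<alpha> n else 0) has_sum infsum \<alpha> ?P) {0<..}"
    using proved_indices_subset by (intro has_sum_cong_neutral) auto
  finally have "((\<lambda>n. a * \<alpha> n + (b - a) * (if n \<in> ?P then \<alpha> n else 0)) has_sum
      a * infsum \<alpha> {0<..} + (b - a) * infsum \<alpha> ?P) {0<..}"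
    using assms by (intro has_sum_add has_sum_cmult_right has_sum_infsum)
  also have "?this \<longleftrightarrow> ((\<lambda>n. \<alpha> n * sigma prov \<psi> a b n T) has_sum
      a * infsum \<alpha> {0<..} + (b - a) * infsum \<alpha> ?P) {0<..}"
    by (intro has_sum_cong) (auto simp: sigma_def proved_indices_def algebra_simps)
  finally have has_sum_value: "((\<lambda>n. \<alpha> n * sigma prov \<psi> a b n T) has_sum
      a * infsum \<alpha> {0<..} + (b - a) * infsum \<alpha> ?P) {0<..}" .
  then have "valuation prov \<psi> a b \<alpha> T = infsum (\<lambda>n. \<alpha> n * sigma prov \<psi> a b n T) {0<..}"
    unfolding valuation_def by (simp add: infsum_greaterThan_eq_suminf has_sum_imp_summable)
  then show ?thesis
    using infsumI[OF has_sum_value] by simp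
qed

locale consequence_relation =
  fixes prov :: "'s set \<Rightarrow> 's \<Rightarrow> bool"
  assumes assumption: "\<chi> \<in> T \<Longrightarrow> prov T \<chi>"
    and cut: "proves_theory prov T U \<Longrightarrow> prov U \<chi> \<Longrightarrow> prov T \<chi>"
begin

lemma proved_indices_mono:
  "proves_theory prov T U \<Longrightarrow> proved_indices prov \<psi> U \<subseteq> proved_indices prov \<psi> T"
  by (auto simp: proved_indices_def intro: cut)

lemma equiv_theory_if_proved_indices_eq:
  assumes "proved_indices prov \<psi> T = proved_indices prov \<psi> U"
    and "T \<subseteq> \<psi> ` {0<..}" and "U \<subseteq> \<psi> ` {0<..}"
  shows "equiv_theory prov T U"
proof -
  have "prov T \<chi> \<longleftrightarrow> prov U \<chi>" if "\<chi> \<in> \<psi> ` {0<..}" for \<chi>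
    using assms(1) that by (auto simp: proved_indices_def)
  then show ?thesis
    using assms(2,3) assumption unfolding equiv_theory_def proves_theory_def by blast
qed

lemma HP_valuation:
  assumes "a \<le> b" and summable: "\<alpha> summable_on {0<..}" and nonneg: "\<And>n. 0 < n \<Longrightarrow> 0 \<le> \<alpha> n"
  shows "HP S prov (valuation prov \<psi> a b \<alpha>)"
proof -
  have "valuation prov \<psi> a b \<alpha> U \<le> valuation prov \<psi> a b \<alpha> T" if "proves_theory prov T U" for T U
  proof -
    have "infsum \<alpha> (proved_indices prov \<psi> U) \<le> infsum \<alpha> (proved_indices prov \<psi> T)"
      using proved_indices_mono[OF that] nonneg
      by (intro infsum_mono2 summable_on_subset_banach[OF summable] proved_indices_subset)
        (auto simp: proved_indices_def)
    then show ?thesis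
      using \<open>a \<le> b\<close> by (simp add: valuation_eq_infsum_proved_indices[OF summable] mult_left_mono)
  qed
  then show ?thesis
    unfolding HP_def by (meson not_le)
qed

lemma EP_valuation:
  assumes "a < b" and summable: "\<alpha> summable_on {0<..}" and "\<And>n. 0 < n \<Longrightarrow> 0 \<le> \<alpha> n"
    and "superdecreasing_on \<alpha> {0<..}" and sentences_listed: "S \<subseteq> \<psi> ` {0<..}"
  shows "EP S prov (valuation prov \<psi> a b \<alpha>)"
  unfolding EP_def
proof (intro allI impI, elim conjE)
  fix T U
  assume "T \<subseteq> S" "U \<subseteq> S" and "valuation prov \<psi> a b \<alpha> T = valuation prov \<psi> a b \<alpha> U"
  then have same_weight:
    "infsum \<alpha> (proved_indices prov \<psi> T) = infsum \<alpha> (proved_indices prov \<psi> U)"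
    using \<open>a < b\<close> by (simp add: valuation_eq_infsum_proved_indices[OF summable])
  have "inj_on (infsum \<alpha>) (Pow {0<..})"
    using assms(2-4) by (intro inj_on_infsum_if_superdecreasing) auto
  then have "proved_indices prov \<psi> T = proved_indices prov \<psi> U"
    using same_weight by (rule inj_onD) (simp_all add: proved_indices_subset)
  then show "equiv_theory prov T U"
    using \<open>T \<subseteq> S\<close> \<open>U \<subseteq> S\<close> sentences_listed by (blast intro: equiv_theory_if_proved_indices_eq)
qed

end

lemma consequence_relation_prop_provable: "consequence_relation (prop_provable A)"
proof
  show "prop_provable A T \<chi>" if "\<chi> \<in> T" for T \<chi>
    using that by (rule prop_provable.PAssm)
  show "prop_provable A T \<chi>"
    if "proves_theory (prop_provable A) T U" and "prop_provable A U \<chi>" for T U \<chi>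
    using that(2,1) unfolding proves_theory_def
    by (induction rule: prop_provable.induct) (auto intro: prop_provable.intros)
qed

lemma consequence_relation_fo_provable: "consequence_relation (fo_provable L)"
proof
  show "fo_provable L T \<chi>" if "\<chi> \<in> T" for T \<chi>
    using that by (rule fo_provable.Assm)
  show "fo_provable L T \<chi>"
    if "proves_theory (fo_provable L) T U" and "fo_provable L U \<chi>" for T U \<chi>
    using that(2,1) unfolding proves_theory_def
    by (induction rule: fo_provable.induct) (auto intro: fo_provable.intros)
qed

theorem theoremI3p12:
  fixes a b :: real and \<alpha> :: "nat \<Rightarrow> real"
    and A :: "'p set" and \<phi> :: "nat \<Rightarrow> 'p pform"
    and L :: "('f, 'r) language" and \<psi> :: "nat \<Rightarrow> ('f, 'r) form"
  assumes "b > a" and "a \<ge> 0"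
    and "\<forall>n>0. \<alpha> n > 0"
    and "summable (\<lambda>n. \<alpha> (Suc n))"
    and "\<forall>n>0. (\<Sum>i. \<alpha> (n + 1 + i)) < \<alpha> n * (1 - a / b)"
  shows "(countable A \<and> \<phi> ` {0<..} = prop_sentences A \<longrightarrow>
           HP (prop_sentences A) (prop_provable A) (valuation (prop_provable A) \<phi> a b \<alpha>) \<and>
           EP (prop_sentences A) (prop_provable A) (valuation (prop_provable A) \<phi> a b \<alpha>)) \<and>
         (countable_language L \<and> \<psi> ` {0<..} = fo_sentences L \<longrightarrow>
           HP (fo_sentences L) (fo_provable L) (valuation (fo_provable L) \<psi> a b \<alpha>) \<and>
           EP (fo_sentences L) (fo_provable L) (valuation (fo_provable L) \<psi> a b \<alpha>))"
proof -
  have nonneg: "0 \<le> \<alpha> n" if "0 < n" for n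
    using assms(3) that by (simp add: less_imp_le)
  have "(\<lambda>n. \<alpha> (Suc n)) summable_on UNIV"
    using assms(4) nonneg by (simp add: summable_on_UNIV_nonneg_real_iff)
  then have summable: "\<alpha> summable_on {0<..}"
    by (simp add: greaterThan_0 summable_on_reindex comp_def)
  have superdecreasing: "superdecreasing_on \<alpha> {0<..}"
    using summable nonneg
  proof (rule superdecreasing_on_if_suminf_tail_less)
    show "(\<Sum>i. \<alpha> (n + 1 + i)) < \<alpha> n * (1 - a / b)" if "0 < n" for n
      using assms(5) that by blast
    show "1 - a / b \<le> 1"
      using assms(1,2) by simp
  qed
  note HP = consequence_relation.HP_valuation[OF _ less_imp_le[OF assms(1)] summable nonneg]
    and EP = consequence_relation.EP_valuation[OF _ assms(1) summable nonneg superdecreasing]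
  show ?thesis
    by (intro conjI impI HP EP consequence_relation_prop_provable consequence_relation_fo_provable)
      auto
qed

end
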